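(* Let $p\geq 3$ be an integer and let $P(x)=x^{2p}+k_px^p+k_{p+1}x^{p-1}+\dots+k_{2p-1}x+k_{2p}$ be a real polynomial with $P(x)\neq x^{2p}$. Consider the case ($*$) $k_p<0$, $k_{p+1}=\dots=k_{2p-1}=0$ and $k_{2p}=\frac{k_p^2}{4}$. If ($*$) does not hold, then $P(x)$ is $\mathcal{R}$ if and only if $P(x)$ is $\mathcal{IR}$. If ($*$) holds, then $P(x)$ is not $\mathcal{IR}$.
   Context: A monic real polynomial $P(x)$ of degree $n$ is realizable ($\mathcal{R}$) if it is the characteristic polynomial of some $n\times n$ entrywise nonnegative matrix; it is irreducibly realizable ($\mathcal{IR}$) if it is the characteristic polynomial of some $n\times n$ irreducible entrywise nonnegative matrix. A square matrix is irreducible if it is not similar by a permutation matrix to a nontrivially block triangular matrix (equivalently, its digraph is strongly connected). *)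

theory Defs
  imports "Jordan_Normal_Form.Char_Poly"
begin

definition nonneg_mat :: "real mat \<Rightarrow> bool" where
  "nonneg_mat A \<longleftrightarrow> (\<forall>i < dim_row A. \<forall>j < dim_col A. 0 \<le> A $$ (i, j))"

definition permutation_mat :: "nat \<Rightarrow> real mat \<Rightarrow> bool" where
  "permutation_mat n Q \<longleftrightarrow>
     (\<exists>\<pi>. \<pi> permutes {..<n} \<and> Q = mat n n (\<lambda>(i, j). if \<pi> i = j then 1 else 0))"

(* Two diagonal blocks suffice, since a finer block triangular form can be regrouped into two
   blocks; lower triangular forms become upper ones after reordering the blocks. *)
definition block_triangular_mat :: "nat \<Rightarrow> real mat \<Rightarrow> bool" where
  "block_triangular_mat n M \<longleftrightarrow>
     (\<exists>r B C D. 0 < r \<and> r < n \<and>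
        B \<in> carrier_mat r r \<and> C \<in> carrier_mat r (n - r) \<and> D \<in> carrier_mat (n - r) (n - r) \<and>
        M = four_block_mat B C (0\<^sub>m (n - r) r) D)"

definition irreducible_mat :: "real mat \<Rightarrow> bool" where
  "irreducible_mat A \<longleftrightarrow> square_mat A \<and>
     \<not> (\<exists>M Q Q'. permutation_mat (dim_row A) Q \<and> similar_mat_wit A M Q Q' \<and>
          block_triangular_mat (dim_row A) M)"

(* Monicity of P need not be required: characteristic polynomials are monic. *)
definition realizable :: "real poly \<Rightarrow> bool" where
  "realizable P \<longleftrightarrow>
     (\<exists>A \<in> carrier_mat (degree P) (degree P). nonneg_mat A \<and> char_poly A = P)"

definition irreducibly_realizable :: "real poly \<Rightarrow> bool" where
  "irreducibly_realizable P \<longleftrightarrow>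
     (\<exists>A \<in> carrier_mat (degree P) (degree P).
        irreducible_mat A \<and> nonneg_mat A \<and> char_poly A = P)"

end

theory Submission
  imports Defs
begin

text \<open>
  Write \<open>n = 2 p\<close>. Newton's identities express \<open>tr (A\<^sup>l)\<close> for \<open>l \<le> n\<close> through the few nonzero
  coefficients of \<open>P\<close>. For nonnegative \<open>A\<close> these traces are nonnegative, which gives \<open>k\<^sub>l \<le> 0\<close> for
  \<open>p \<le> l < 2 p\<close>, and Cauchy--Schwarz on the diagonal of \<open>A\<^sup>p\<close> gives \<open>k\<^sub>2\<^sub>p \<le> k\<^sub>p\<^sup>2 / 4\<close>. Conversely,
  under these inequalities \<open>P\<close> is the characteristic polynomial of a Hamiltonian path with
  nonnegative extra arcs into its first and out of its last vertex. Splitting the weight \<open>- k\<^sub>l\<close>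
  evenly between the two possible cycles of length \<open>l\<close> makes this digraph strongly connected unless
  only the two \<open>p\<close>-cycles carry weight, which is the exceptional case.

  In the exceptional case \<open>P = (x\<^sup>p - w)\<^sup>2\<close>, equality in Cauchy--Schwarz makes the diagonal of \<open>A\<^sup>p\<close>
  constantly \<open>w\<close>, so \<open>A\<^sup>p - w I\<close> is nonnegative, and by Cayley--Hamilton its square is \<open>0\<close>. If \<open>A\<close>
  is irreducible, then \<open>A\<^sup>p = w I\<close>; but then at most \<open>p < n\<close> vertices are reachable from a vertex.
\<close>

subsection \<open>Irreducibility and closed index sets\<close>

text \<open>Row i of \<open>Q\<close> has its single 1 in column \<open>\<pi> i\<close>, so the
  claim is the equation \<open>A * Q = Q * M\<close> read at (i, \<open>\<pi> j\<close>); the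
  entries of \<open>Q'\<close> never enter.\<close>

lemma permutation_mat_conj:
  fixes A M Q :: "'a :: comm_ring_1 mat"
  assumes A: "A \<in> carrier_mat n n" and \<pi>: "\<pi> permutes {..<n}"
    and Q: "Q = mat n n (\<lambda>(i, j). if \<pi> i = j then 1 else 0)"
    and sim: "similar_mat_wit A M Q Q'" and ij: "i < n" "j < n"
  shows "A $$ (i, j) = M $$ (\<pi> i, \<pi> j)"
proof -
  note w = similar_mat_witD2[OF A sim]
  have p: "\<pi> i < n" "\<pi> j < n" using \<pi> ij permutes_in_image by fastforce+
  have inj: "\<pi> l = \<pi> j \<longleftrightarrow> l = j" for l using permutes_inj[OF \<pi>] by (auto dest: injD)
  have "A * Q = Q * M * (Q' * Q)"
    using w assoc_mult_mat[of "Q * M" n n Q' n Q n] by (metis mult_carrier_mat)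
  then have "A * Q = Q * M" using w(2,5,6) by simp
  then have "(A * Q) $$ (i, \<pi> j) = (Q * M) $$ (i, \<pi> j)" by simp
  moreover have "(A * Q) $$ (i, \<pi> j) = A $$ (i, j)"
    using A ij p by (simp add: Q scalar_prod_def inj if_distrib[of "\<lambda>x. _ * x"] cong: if_cong)
  moreover have "(Q * M) $$ (i, \<pi> j) = M $$ (\<pi> i, \<pi> j)"
    using w(5) ij p by (simp add: Q scalar_prod_def if_distrib[of "\<lambda>x. x * _"] cong: if_cong)
  ultimately show ?thesis by simp
qed

lemma permutation_mat_similar:
  fixes A :: "'a :: field mat"
  assumes A: "A \<in> carrier_mat n n" and \<pi>: "\<pi> permutes {..<n}"
  defines "Q \<equiv> mat n n (\<lambda>(i, j). if \<pi> i = j then 1 else 0)"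
  shows "\<exists>M Q'. similar_mat_wit A M Q Q'"
proof -
  define Q' :: "'a mat" where "Q' = mat n n (\<lambda>(i, j). if \<pi> j = i then 1 else 0)"
  have p: "\<pi> i < n" if "i < n" for i using \<pi> that permutes_in_image by fastforce
  have inj: "\<pi> l = \<pi> j \<longleftrightarrow> l = j" for l j using permutes_inj[OF \<pi>] by (auto dest: injD)
  have QQ': "Q * Q' = 1\<^sub>m n"
    by (rule eq_matI)
      (auto simp: Q_def Q'_def scalar_prod_def p inj if_distrib[of "\<lambda>x. x * _"] cong: if_cong)
  moreover have "Q \<in> carrier_mat n n" "Q' \<in> carrier_mat n n" by (auto simp: Q_def Q'_def)
  moreover have "Q' * Q = 1\<^sub>m n"
    using QQ' by (rule mat_mult_left_right_inverse[rotated 2]) (auto simp: Q_def Q'_def)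
  moreover have "A = Q * (Q' * A * Q) * Q'"
  proof -
    have c: "Q \<in> carrier_mat n n" "Q' \<in> carrier_mat n n" by (simp_all add: Q_def Q'_def)
    have "Q * (Q' * A * Q) = Q * (Q' * (A * Q))"
      using A c by (simp add: assoc_mult_mat[of _ n n _ n _ n])
    also have "\<dots> = Q * Q' * (A * Q)"
      using A c by (simp add: assoc_mult_mat[of Q n n Q' n "A * Q" n])
    also have "\<dots> = A * Q" using A c QQ' by simp
    finally have "Q * (Q' * A * Q) * Q' = A * (Q * Q')"
      using A c by (simp add: assoc_mult_mat[of A n n Q n Q' n])
    then show ?thesis using A QQ' by simp
  qed
  ultimately have "similar_mat_wit A (Q' * A * Q) Q Q'"
    using A by (intro similar_mat_witI[of _ _ n]) auto
  then show ?thesis by blast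
qed

lemma block_triangular_mat_iff:
  assumes "M \<in> carrier_mat n n"
  shows "block_triangular_mat n M \<longleftrightarrow>
    (\<exists>r. 0 < r \<and> r < n \<and> (\<forall>i\<in>{r..<n}. \<forall>j<r. M $$ (i, j) = 0))"
proof
  assume "block_triangular_mat n M"
  then show "\<exists>r. 0 < r \<and> r < n \<and> (\<forall>i\<in>{r..<n}. \<forall>j<r. M $$ (i, j) = 0)"
    unfolding block_triangular_mat_def by fastforce
next
  assume "\<exists>r. 0 < r \<and> r < n \<and> (\<forall>i\<in>{r..<n}. \<forall>j<r. M $$ (i, j) = 0)"
  then obtain r where r: "0 < r" "r < n" "\<And>i j. r \<le> i \<Longrightarrow> i < n \<Longrightarrow> j < r \<Longrightarrow> M $$ (i, j) = 0"
    by auto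
  define B where "B = mat r r (\<lambda>(i, j). M $$ (i, j))"
  define C where "C = mat r (n - r) (\<lambda>(i, j). M $$ (i, j + r))"
  define D where "D = mat (n - r) (n - r) (\<lambda>(i, j). M $$ (i + r, j + r))"
  have "M = four_block_mat B C (0\<^sub>m (n - r) r) D"
    using assms r by (intro eq_matI) (auto simp: B_def C_def D_def)
  with r(1,2) show "block_triangular_mat n M"
    unfolding block_triangular_mat_def
    by (intro exI[of _ r] exI[of _ B] exI[of _ C] exI[of _ D]) (auto simp: B_def C_def D_def)
qed

text \<open>Relabelling puts \<open>S\<close> last. Block triangular forms have their zero block in
  the lower left, so a set closed under arcs has to occupy the bottom rows.\<close>

lemma permutes_separating:
  assumes "S \<subseteq> {..<n :: nat}"
  obtains \<pi> where "\<pi> permutes {..<n}" "\<And>i. i < n \<Longrightarrow> i \<in> S \<longleftrightarrow> n - card S \<le> \<pi> i"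
proof -
  define T where "T = {..<n} - S"
  have fin: "finite S" "finite T" using assms finite_subset by (auto simp: T_def)
  have cards: "card S \<le> n" "card T = n - card S"
    using assms fin card_mono[of "{..<n}" S] by (auto simp: T_def card_Diff_subset)
  have "\<exists>f. bij_betw f T {..<n - card S}" "\<exists>g. bij_betw g S {n - card S..<n}"
    using fin cards by (auto intro!: finite_same_card_bij)
  then obtain f g where f: "bij_betw f T {..<n - card S}" and g: "bij_betw g S {n - card S..<n}"
    by blast
  define \<pi> where "\<pi> i = (if i \<in> T then f i else if i \<in> S then g i else i)" for i
  have "bij_betw \<pi> T {..<n - card S}"
    using f bij_betw_cong[of T f \<pi>] by (simp add: \<pi>_def)
  moreover have "bij_betw \<pi> S {n - card S..<n}"
    using g bij_betw_cong[of S g \<pi>] by (simp add: \<pi>_def T_def)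
  ultimately have "bij_betw \<pi> (T \<union> S) ({..<n - card S} \<union> {n - card S..<n})"
    by (rule bij_betw_combine) auto
  moreover have "T \<union> S = {..<n}" "{..<n - card S} \<union> {n - card S..<n} = {..<n}"
    using assms by (auto simp: T_def)
  ultimately have "\<pi> permutes {..<n}"
    by (intro bij_imp_permutes) (auto simp: \<pi>_def)
  moreover have "i \<in> S \<longleftrightarrow> n - card S \<le> \<pi> i" if "i < n" for i
  proof (cases "i \<in> S")
    case True
    then show ?thesis using bij_betw_apply[OF g True] by (simp add: \<pi>_def T_def)
  next
    case False
    then have "i \<in> T" using that by (simp add: T_def)
    then show ?thesis using bij_betw_apply[OF f] False by (fastforce simp: \<pi>_def)
  qed
  ultimately show ?thesis by (rule that)
qed

text \<open>A set closed under the arcs of \<open>A\<close> has no arc to its complement; moved to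
  the last indices, it yields exactly the zero block. Conversely, the indices sent into the lower
  diagonal block form a closed set.\<close>

lemma irreducible_mat_iff:
  assumes A: "A \<in> carrier_mat n n"
  shows "irreducible_mat A \<longleftrightarrow>
    (\<forall>S. S \<noteq> {} \<longrightarrow> S \<subseteq> {..<n} \<longrightarrow> (\<forall>i\<in>S. \<forall>j<n. A $$ (i, j) \<noteq> 0 \<longrightarrow> j \<in> S) \<longrightarrow> S = {..<n})"
    (is "_ \<longleftrightarrow> ?strong")
proof
  assume irr: "irreducible_mat A"
  show ?strong
  proof (intro allI impI, rule ccontr)
    fix S assume S: "S \<noteq> {}" "S \<subseteq> {..<n}" "S \<noteq> {..<n}"
      and closed: "\<forall>i\<in>S. \<forall>j<n. A $$ (i, j) \<noteq> 0 \<longrightarrow> j \<in> S"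
    obtain \<pi> where \<pi>: "\<pi> permutes {..<n}" and sep: "\<And>i. i < n \<Longrightarrow> i \<in> S \<longleftrightarrow> n - card S \<le> \<pi> i"
      using permutes_separating[OF S(2)] by blast
    define Q :: "real mat" where "Q = mat n n (\<lambda>(i, j). if \<pi> i = j then 1 else 0)"
    obtain M Q' where sim: "similar_mat_wit A M Q Q'"
      using permutation_mat_similar[OF A \<pi>] unfolding Q_def by blast
    have "M $$ (i, j) = 0" if "n - card S \<le> i" "i < n" "j < n - card S" for i j
    proof -
      define i' j' where "i' = inv_into UNIV \<pi> i" and "j' = inv_into UNIV \<pi> j"
      have ij: "\<pi> i' = i" "\<pi> j' = j" using permutes_inverses[OF \<pi>] by (auto simp: i'_def j'_def)
      then have lt: "i' < n" "j' < n"
        using permutes_in_image[OF \<pi>, of i'] permutes_in_image[OF \<pi>, of j'] that by auto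
      have "A $$ (i', j') = 0" using closed sep[OF lt(1)] sep[OF lt(2)] ij lt that by auto
      then show ?thesis using permutation_mat_conj[OF A \<pi> Q_def sim lt] ij by simp
    qed
    moreover have "card S < n" "0 < card S"
      using S psubset_card_mono[of "{..<n}" S] finite_subset[OF S(2)] by (auto simp: card_gt_0_iff)
    ultimately have "block_triangular_mat n M"
      using block_triangular_mat_iff[OF similar_mat_witD2(5)[OF A sim]]
      by (auto intro!: exI[of _ "n - card S"])
    moreover have "permutation_mat n Q" unfolding permutation_mat_def Q_def using \<pi> by blast
    ultimately show False using irr sim A unfolding irreducible_mat_def by auto
  qed
next
  assume strong: ?strong
  have False if Q: "permutation_mat n Q" and sim: "similar_mat_wit A M Q Q'"
    and M: "block_triangular_mat n M" for M Q Q'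
  proof -
    obtain \<pi> where \<pi>: "\<pi> permutes {..<n}"
      and Q_def: "Q = mat n n (\<lambda>(i, j). if \<pi> i = j then 1 else 0)"
      using Q unfolding permutation_mat_def by blast
    obtain r where r: "0 < r" "r < n" and zero: "\<And>i j. r \<le> i \<Longrightarrow> i < n \<Longrightarrow> j < r \<Longrightarrow> M $$ (i, j) = 0"
      using M block_triangular_mat_iff[OF similar_mat_witD2(5)[OF A sim]] by auto
    have p: "\<pi> i < n" if "i < n" for i using \<pi> that permutes_in_image by fastforce
    have surj: "\<exists>i<n. \<pi> i = j" if "j < n" for j
      using permutes_image[OF \<pi>] that by (metis imageE lessThan_iff)
    define S where "S = {i. i < n \<and> r \<le> \<pi> i}"
    have "S \<noteq> {}" using surj[OF r(2)] by (auto simp: S_def)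
    moreover have "\<forall>i\<in>S. \<forall>j<n. A $$ (i, j) \<noteq> 0 \<longrightarrow> j \<in> S"
    proof (intro ballI allI impI)
      fix i j assume "i \<in> S" "j < n" "A $$ (i, j) \<noteq> 0"
      then show "j \<in> S"
        using permutation_mat_conj[OF A \<pi> Q_def sim, of i j] zero[of "\<pi> i" "\<pi> j"] p[of i]
        by (auto simp: S_def not_less[symmetric])
    qed
    moreover have "S \<subseteq> {..<n}" by (auto simp: S_def)
    ultimately have "S = {..<n}" using strong by blast
    moreover obtain i where i: "i < n" "\<pi> i = 0" using surj[of 0] r by auto
    ultimately have "i \<in> S" by simp
    then show False using r i by (simp add: S_def)
  qed
  moreover have "dim_row A = n" "square_mat A" using A by auto
  ultimately show "irreducible_mat A" unfolding irreducible_mat_def by metis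
qed

subsection \<open>Cayley--Hamilton and Newton's identities\<close>

lemma index_mult_mat_sum:
  assumes "A \<in> carrier_mat n n" "B \<in> carrier_mat n n" "i < n" "j < n"
  shows "(A * B) $$ (i, j) = (\<Sum>l<n. A $$ (i, l) * B $$ (l, j))"
  using assms by (auto simp: scalar_prod_def atLeast0LessThan intro!: sum.cong)

lemma pow_mat_add:
  assumes "A \<in> carrier_mat n n"
  shows "A ^\<^sub>m (a + b) = A ^\<^sub>m a * A ^\<^sub>m b"
proof (induction b)
  case (Suc b)
  have "A ^\<^sub>m (a + Suc b) = A ^\<^sub>m a * A ^\<^sub>m b * A"
    using Suc by simp
  also have "\<dots> = A ^\<^sub>m a * (A ^\<^sub>m b * A)"
    using assms by (intro assoc_mult_mat[of _ n n _ n _ n]) auto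
  finally show ?case by simp
qed (use assms in simp)

lemma index_pow_mat_Suc:
  assumes "A \<in> carrier_mat n n" "i < n" "j < n"
  shows "(A ^\<^sub>m Suc s) $$ (i, j) = (\<Sum>l<n. A $$ (i, l) * (A ^\<^sub>m s) $$ (l, j))"
  using index_mult_mat_sum[of A n "A ^\<^sub>m s" i j] pow_mat_add[OF assms(1), of 1 s] assms by simp

definition trace_mat :: "'a :: comm_monoid_add mat \<Rightarrow> 'a" where
  "trace_mat A = (\<Sum>i<dim_row A. A $$ (i, i))"

context
  fixes A :: "'a :: idom mat" and n :: nat
  assumes A: "A \<in> carrier_mat n n"
begin

text \<open>An entry of (x I - A) adj(x I - A) = det(x I - A) I, solved for x times the adjugate
  entry; \<open>pCons 0\<close> is multiplication by x.\<close>

lemma index_adj_char_poly_matrix: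
  assumes ij: "i < n" "j < n"
  shows "pCons 0 (adj_mat (char_poly_matrix A) $$ (i, j)) =
    (\<Sum>l<n. Polynomial.smult (A $$ (i, l)) (adj_mat (char_poly_matrix A) $$ (l, j))) +
    (if i = j then char_poly A else 0)"
proof -
  let ?K = "char_poly_matrix A"
  let ?q = "adj_mat ?K"
  have K: "?K \<in> carrier_mat n n" using A by simp
  have q: "?q \<in> carrier_mat n n" using adj_mat(1)[OF K] .
  have "(?K * ?q) $$ (i, j) = (if i = j then char_poly A else 0)"
    unfolding adj_mat(2)[OF K] using ij by (simp add: char_poly_def)
  moreover have "(?K * ?q) $$ (i, j) = (\<Sum>l<n. ?K $$ (i, l) * ?q $$ (l, j))"
    using K q ij by (rule index_mult_mat_sum)
  moreover have "\<dots> = (\<Sum>l<n. (if l = i then pCons 0 (?q $$ (i, j)) else 0) - Polynomial.smult (A $$ (i, l)) (?q $$ (l, j)))"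
    using A ij by (intro sum.cong) (auto simp: char_poly_matrix_def)
  moreover have "\<dots> = pCons 0 (?q $$ (i, j)) - (\<Sum>l<n. Polynomial.smult (A $$ (i, l)) (?q $$ (l, j)))"
    using ij by (simp add: sum_subtractf)
  ultimately show ?thesis by (simp add: algebra_simps)
qed

text \<open>The inner sums are the Horner tails of the characteristic polynomial at
  \<open>A\<close>. Each tail is \<open>A\<close> times the next one plus a multiple of the
  identity; the extra top term has a coefficient beyond the degree.\<close>

lemma sum_coeff_char_poly_shift:
  assumes ij: "i < n" "j < n"
  shows "(\<Sum>l<n. A $$ (i, l) * (\<Sum>s\<le>n. coeff (char_poly A) (Suc t + s) * (A ^\<^sub>m s) $$ (l, j))) +
    (if i = j then coeff (char_poly A) t else 0) =
    (\<Sum>s\<le>n. coeff (char_poly A) (t + s) * (A ^\<^sub>m s) $$ (i, j))" (is "?L + ?d = ?R")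
proof -
  let ?c = "coeff (char_poly A)"
  have "?L = (\<Sum>s\<le>n. ?c (Suc t + s) * (A ^\<^sub>m Suc s) $$ (i, j))"
    unfolding index_pow_mat_Suc[OF A ij] sum_distrib_left
    by (subst sum.swap) (simp add: mult_ac)
  moreover have "?d = ?c t * (A ^\<^sub>m 0) $$ (i, j)" using A ij by simp
  ultimately have "?L + ?d = (\<Sum>s\<le>Suc n. ?c (t + s) * (A ^\<^sub>m s) $$ (i, j))"
    by (subst sum.atMost_Suc_shift) (simp add: add_ac del: pow_mat.simps)
  also have "\<dots> = ?R"
    using degree_monic_char_poly[OF A] by (simp add: coeff_eq_0)
  finally show ?thesis .
qed

text \<open>The coefficients of the adjugate and the Horner tails obey the same recursion and both
  vanish at high index, so downward induction on \<open>t\<close> identifies them.\<close>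

lemma coeff_adj_char_poly_matrix:
  assumes ij: "i < n" "j < n"
  shows "coeff (adj_mat (char_poly_matrix A) $$ (i, j)) t =
    (\<Sum>s\<le>n. coeff (char_poly A) (Suc t + s) * (A ^\<^sub>m s) $$ (i, j))"
proof -
  let ?q = "adj_mat (char_poly_matrix A)"
  \<comment> \<open>\<open>N\<close> exceeds all degrees in the adjugate and is at least
    \<open>n\<close>, so both sides vanish from \<open>N\<close> on.\<close>
  define N where "N = n + (\<Sum>i<n. \<Sum>j<n. Suc (degree (?q $$ (i, j))))"
  have N: "degree (?q $$ (i, j)) < N" if "i < n" "j < n" for i j
  proof -
    have "Suc (degree (?q $$ (i, j))) \<le> (\<Sum>j<n. Suc (degree (?q $$ (i, j))))"
      using that by (intro member_le_sum) auto
    also have "\<dots> \<le> (\<Sum>i<n. \<Sum>j<n. Suc (degree (?q $$ (i, j))))"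
      using that by (intro member_le_sum[of i]) auto
    finally show ?thesis by (simp add: N_def)
  qed
  have "t \<ge> N \<or> (\<exists>d. t + d = N)" by presburger
  then show ?thesis
  proof (elim disjE exE)
    assume "t \<ge> N"
    then show ?thesis using N[OF ij] degree_monic_char_poly[OF A]
      by (auto simp: coeff_eq_0 N_def)
  next
    fix d assume "t + d = N"
    then show ?thesis using ij
    proof (induction d arbitrary: t i j)
      case 0
      then show ?case using N[OF 0(2,3)] degree_monic_char_poly[OF A]
        by (auto simp: coeff_eq_0 N_def)
    next
      case (Suc d)
      have "coeff (?q $$ (i, j)) t = coeff (pCons 0 (?q $$ (i, j))) (Suc t)" by simp
      also have "\<dots> = (\<Sum>l<n. A $$ (i, l) * coeff (?q $$ (l, j)) (Suc t)) +
          (if i = j then coeff (char_poly A) (Suc t) else 0)"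
        unfolding index_adj_char_poly_matrix[OF Suc.prems(2,3)] by (simp add: coeff_sum)
      also have "(\<Sum>l<n. A $$ (i, l) * coeff (?q $$ (l, j)) (Suc t)) =
          (\<Sum>l<n. A $$ (i, l) * (\<Sum>s\<le>n. coeff (char_poly A) (Suc (Suc t) + s) * (A ^\<^sub>m s) $$ (l, j)))"
        using Suc.prems by (intro sum.cong refl arg_cong2[where f = "(*)"] Suc.IH) auto
      finally show ?case
        unfolding sum_coeff_char_poly_shift[OF Suc.prems(2,3)] .
    qed
  qed
qed

text \<open>The constant coefficient of x adj(x I - A) is 0; the adjugate identity at degree 0 turns
  this into the claim.\<close>

lemma cayley_hamilton_index:
  assumes ij: "i < n" "j < n"
  shows "(\<Sum>s\<le>n. coeff (char_poly A) s * (A ^\<^sub>m s) $$ (i, j)) = 0"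
proof -
  let ?q = "adj_mat (char_poly_matrix A)"
  have "0 = coeff (pCons 0 (?q $$ (i, j))) 0" by simp
  also have "\<dots> = (\<Sum>l<n. A $$ (i, l) * coeff (?q $$ (l, j)) 0) +
      (if i = j then coeff (char_poly A) 0 else 0)"
    unfolding index_adj_char_poly_matrix[OF ij] by (simp add: coeff_sum)
  also have "\<dots> = (\<Sum>s\<le>n. coeff (char_poly A) (0 + s) * (A ^\<^sub>m s) $$ (i, j))"
    unfolding sum_coeff_char_poly_shift[OF ij, symmetric]
    using ij by (simp add: coeff_adj_char_poly_matrix)
  finally show ?thesis by simp
qed

text \<open>A diagonal cofactor of x I - A is the characteristic polynomial of a principal
  submatrix, and these sum to the derivative.\<close>

lemma trace_adj_char_poly_matrix:
  "(\<Sum>i<n. adj_mat (char_poly_matrix A) $$ (i, i)) = pderiv (char_poly A)"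
proof -
  have "adj_mat (char_poly_matrix A) $$ (i, i) = char_poly (mat_delete A i i)" if "i < n" for i
  proof -
    have "mat_delete (char_poly_matrix A) i i = char_poly_matrix (mat_delete A i i)"
      using A that by (intro eq_matI) (auto simp: mat_delete_def char_poly_matrix_def)
    then show ?thesis
      using A that by (simp add: adj_mat_def cofactor_def char_poly_def char_poly_matrix_def)
  qed
  then show ?thesis unfolding pderiv_char_poly[OF A] by simp
qed

text \<open>Newton's identities without eigenvalues: for positive \<open>t\<close>, the coefficient
  at t - 1 of the derivative is that of the trace of the adjugate; for \<open>t = 0\<close> this is
  the trace of Cayley--Hamilton.\<close>

lemma newton_trace:
  "of_nat t * coeff (char_poly A) t =
    (\<Sum>s\<le>n. coeff (char_poly A) (t + s) * trace_mat (A ^\<^sub>m s))"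
proof -
  have *: "(\<Sum>s\<le>n. coeff (char_poly A) (t + s) * trace_mat (A ^\<^sub>m s)) =
      (\<Sum>i<n. \<Sum>s\<le>n. coeff (char_poly A) (t + s) * (A ^\<^sub>m s) $$ (i, i))" for t
    using A unfolding trace_mat_def by (subst sum.swap) (simp add: sum_distrib_left)
  show ?thesis
  proof (cases t)
    case 0
    then show ?thesis unfolding * by (simp add: cayley_hamilton_index)
  next
    case (Suc u)
    have "of_nat t * coeff (char_poly A) t =
        coeff (\<Sum>i<n. adj_mat (char_poly_matrix A) $$ (i, i)) u"
      unfolding trace_adj_char_poly_matrix coeff_pderiv Suc ..
    also have "\<dots> = (\<Sum>i<n. \<Sum>s\<le>n. coeff (char_poly A) (t + s) * (A ^\<^sub>m s) $$ (i, i))"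
      unfolding coeff_sum Suc by (intro sum.cong refl coeff_adj_char_poly_matrix) auto
    finally show ?thesis unfolding * .
  qed
qed

end

subsection \<open>A Hamiltonian path with arcs into its first and out of its last vertex\<close>

text \<open>The vector \<open>K v\<close> vanishes except in its last entry. Multiplying it by the
  adjugate and reading entry 0 gives \<open>det K\<close> as that entry times a corner cofactor,
  which is 1.\<close>

lemma det_hessenberg:
  fixes K :: "'a :: comm_ring_1 mat"
  assumes K: "K \<in> carrier_mat (Suc m) (Suc m)"
    and diag: "\<And>i. i < m \<Longrightarrow> K $$ (i, Suc i) = -1"
    and zero: "\<And>i j. Suc i < j \<Longrightarrow> j \<le> m \<Longrightarrow> K $$ (i, j) = 0"
    and v0: "v 0 = 1"
    and rows: "\<And>i. i < m \<Longrightarrow> (\<Sum>j\<le>m. K $$ (i, j) * v j) = 0"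
  shows "det K = (\<Sum>j\<le>m. K $$ (m, j) * v j)"
proof -
  let ?q = "adj_mat K"
  \<comment> \<open>\<open>D\<close> is lower triangular with diagonal -1, so its determinant (-1)^m
    cancels the sign of the cofactor.\<close>
  define D where "D = mat_delete K m 0"
  have q: "?q \<in> carrier_mat (Suc m) (Suc m)" using adj_mat(1)[OF K] .
  have D: "D \<in> carrier_mat m m" "\<And>i j. i < m \<Longrightarrow> j < m \<Longrightarrow> D $$ (i, j) = K $$ (i, Suc j)"
    using K by (auto simp: D_def mat_delete_def)
  have "det D = prod_list (diag_mat D)"
    using D zero by (intro det_lower_triangular[of m]) auto
  also have "diag_mat D = map (\<lambda>_. -1) [0..<m]"
    using D diag by (auto simp: diag_mat_def)
  also have "prod_list \<dots> = (-1) ^ m" by (induction m) auto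
  finally have q0: "?q $$ (0, m) = 1"
    using K by (simp add: adj_mat_def cofactor_def flip: D_def power_mult_distrib)
  have "det K = (\<Sum>j\<le>m. (if j = 0 then det K * v j else 0))" using v0 by simp
  also have "\<dots> = (\<Sum>j\<le>m. (?q * K) $$ (0, j) * v j)"
    unfolding adj_mat(3)[OF K] by (intro sum.cong) auto
  also have "\<dots> = (\<Sum>j\<le>m. \<Sum>l\<le>m. ?q $$ (0, l) * (K $$ (l, j) * v j))"
    by (intro sum.cong refl, subst index_mult_mat_sum[OF q K])
      (auto simp: lessThan_Suc_atMost sum_distrib_right mult.assoc)
  also have "\<dots> = (\<Sum>l\<le>m. ?q $$ (0, l) * (\<Sum>j\<le>m. K $$ (l, j) * v j))"
    by (subst sum.swap) (simp add: sum_distrib_left)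
  also have "\<dots> = (\<Sum>l\<le>m. if l = m then (\<Sum>j\<le>m. K $$ (m, j) * v j) else 0)"
    using rows q0 by (intro sum.cong) (auto simp: le_less)
  finally show ?thesis by simp
qed

text \<open>The argument of \<open>a\<close> is a cycle length: the arc from i to 0 closes a cycle
  of length i + 1, the arc from m to j one of length m + 1 - j. Each length up to \<open>m\<close>
  occurs twice; \<open>c\<close> closes the Hamiltonian cycle.\<close>

definition bordered_path_mat :: "nat \<Rightarrow> (nat \<Rightarrow> real) \<Rightarrow> real \<Rightarrow> real mat" where
  "bordered_path_mat m a c = mat (Suc m) (Suc m) (\<lambda>(i, j).
     (if j = Suc i then 1 else 0) + (if j = 0 \<and> i < m then a (Suc i) else 0) +
     (if i = m then if j = 0 then c else a (Suc m - j) else 0))"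

lemma bordered_path_mat_carrier [simp]:
  "bordered_path_mat m a c \<in> carrier_mat (Suc m) (Suc m)"
  by (simp add: bordered_path_mat_def)

text \<open>All rows of \<open>x I - H\<close> but the last annihilate the vector of these polynomials.\<close>
primrec path_poly :: "(nat \<Rightarrow> real) \<Rightarrow> nat \<Rightarrow> real poly" where
  "path_poly a 0 = 1"
| "path_poly a (Suc i) = pCons 0 (path_poly a i) - [:a (Suc i):]"

lemma coeff_path_poly:
  "coeff (path_poly a i) d = (if d = i then 1 else if d < i then - a (i - d) else 0)"
  by (induction i arbitrary: d) (auto simp: coeff_pCons split: nat.split)

lemma char_poly_bordered_path_mat:
  "char_poly (bordered_path_mat m a c) =
    pCons 0 (path_poly a m) -
    (\<Sum>j\<le>m. Polynomial.smult (if j = 0 then c else a (Suc m - j)) (path_poly a j))"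
proof -
  let ?A = "bordered_path_mat m a c"
  let ?v = "path_poly a"
  let ?K = "char_poly_matrix ?A"
  have A: "?A \<in> carrier_mat (Suc m) (Suc m)" by simp
  have K: "?K $$ (i, j) = (if i = j then [:0, 1:] else 0) - [:?A $$ (i, j):]"
    if "i \<le> m" "j \<le> m" for i j
    using that carrier_matD[OF A] by (auto simp: char_poly_matrix_def)
  have Kv: "(\<Sum>j\<le>m. ?K $$ (i, j) * ?v j) =
      pCons 0 (?v i) - (\<Sum>j\<le>m. Polynomial.smult (?A $$ (i, j)) (?v j))" if "i \<le> m" for i
  proof -
    have "(\<Sum>j\<le>m. ?K $$ (i, j) * ?v j) =
        (\<Sum>j\<le>m. (if i = j then pCons 0 (?v j) else 0) - Polynomial.smult (?A $$ (i, j)) (?v j))"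
      using that by (intro sum.cong) (auto simp: K)
    then show ?thesis using that by (simp add: sum_subtractf)
  qed
  have "det ?K = (\<Sum>j\<le>m. ?K $$ (m, j) * ?v j)"
  proof (rule det_hessenberg)
    fix i assume i: "i < m"
    have "(\<Sum>j\<le>m. Polynomial.smult (?A $$ (i, j)) (?v j)) =
        (\<Sum>j\<le>m. (if j = Suc i then ?v j else 0) + (if j = 0 then [:a (Suc i):] else 0))"
      using i by (intro sum.cong) (auto simp: bordered_path_mat_def)
    then have "(\<Sum>j\<le>m. Polynomial.smult (?A $$ (i, j)) (?v j)) = ?v (Suc i) + [:a (Suc i):]"
      using i by (simp add: sum.distrib)
    then show "(\<Sum>j\<le>m. ?K $$ (i, j) * ?v j) = 0" using i by (simp add: Kv)
  qed (auto simp: K, auto simp: bordered_path_mat_def one_pCons)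
  also have "\<dots> = pCons 0 (?v m) -
      (\<Sum>j\<le>m. Polynomial.smult (if j = 0 then c else a (Suc m - j)) (?v j))"
    unfolding Kv[OF order_refl] by (intro arg_cong2[where f = "(-)"] sum.cong)
      (auto simp: bordered_path_mat_def)
  finally show ?thesis unfolding char_poly_def .
qed

text \<open>Path arcs lead from anywhere to \<open>m\<close>, so a way from \<open>m\<close> back to
  0 suffices. Either \<open>c\<close> provides it, or the two cycles of some length l overlap: the
  arc from m to m + 1 - l lands at or before l - 1, from which an arc of weight \<open>a l\<close>
  returns to 0.\<close>

lemma irreducible_bordered_path_mat:
  assumes pos: "\<And>i. i \<le> Suc m \<Longrightarrow> 0 \<le> a i" "0 \<le> c"
    and conn: "0 < c \<or> (\<exists>l\<le>m. Suc m < 2 * l \<and> 0 < a l)"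
  shows "irreducible_mat (bordered_path_mat m a c)"
proof -
  let ?A = "bordered_path_mat m a c"
  have "S = {..<Suc m}" if S: "S \<noteq> {}" "S \<subseteq> {..<Suc m}"
    and closed: "\<forall>i\<in>S. \<forall>j<Suc m. ?A $$ (i, j) \<noteq> 0 \<longrightarrow> j \<in> S" for S
  proof -
    have arc: "j \<in> S" if "i \<in> S" "j \<le> m" "0 < ?A $$ (i, j)" for i j
      using closed that by fastforce
    have step: "Suc i \<in> S" if "i \<in> S" "i < m" for i
      using that pos by (intro arc[OF that(1)]) (auto simp: bordered_path_mat_def add_pos_nonneg)
    have up: "j \<in> S" if "i \<in> S" "i \<le> j" "j \<le> m" for i j
      using that(2,3,1) by (induction j rule: dec_induct) (auto intro: step)
    obtain i where "i \<in> S" using S by blast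
    then have m: "m \<in> S" using S up[of i m] by auto
    have "0 \<in> S"
      using conn
    proof (elim disjE exE conjE)
      assume "0 < c"
      then show ?thesis using m by (intro arc[OF m]) (auto simp: bordered_path_mat_def)
    next
      fix l assume l: "l \<le> m" "Suc m < 2 * l" "0 < a l"
      have "Suc m - l \<in> S"
        using l by (intro arc[OF m]) (auto simp: bordered_path_mat_def Suc_diff_le add_nonneg_pos)
      then have "l - 1 \<in> S" by (rule up) (use l in auto)
      then show ?thesis by (rule arc) (use l in \<open>auto simp: bordered_path_mat_def\<close>)
    qed
    then have "{..<Suc m} \<subseteq> S" using up by auto
    then show ?thesis using S by blast
  qed
  then show ?thesis using irreducible_mat_iff[of ?A "Suc m"] by simp
qed

text \<open>Cycles shorter than \<open>p\<close> carry no weight, so two disjoint weighted cycles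
  fit into 2 p vertices only if both have length p. That pair yields the square.\<close>

lemma coeff_char_poly_bordered_path_mat:
  assumes a: "\<And>l. l < p \<Longrightarrow> a l = 0" and p: "2 * p = Suc m"
  shows "coeff (char_poly (bordered_path_mat m a c)) d =
    (if d = 0 then (a p)\<^sup>2 - c else if d < 2 * p then - 2 * a (2 * p - d)
     else if d = 2 * p then 1 else 0)"
proof -
  let ?b = "\<lambda>j. if j = 0 then c else a (Suc m - j)"
  have "p \<le> m" "0 < p" using p by auto
  have split: "?b j * coeff (path_poly a j) d =
      (if j = d then ?b d else 0) - (if d = 0 \<and> j = p then (a p)\<^sup>2 else 0)" if "j \<le> m" for j
  proof (cases "d < j")
    case True
    \<comment> \<open>The two cycle lengths add up to 2 p - d, so both being at least p forces d = 0
      and j = p.\<close>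
    have "a (Suc m - j) * a (j - d) = (if d = 0 \<and> j = p then (a p)\<^sup>2 else 0)"
    proof (cases "Suc m - j < p \<or> j - d < p")
      case True
      then show ?thesis using a p by auto
    next
      case False
      then have "d = 0" "j = p" using p \<open>d < j\<close> that by auto
      then show ?thesis using p by (simp add: power2_eq_square flip: p)
    qed
    then show ?thesis using True by (simp add: coeff_path_poly)
  next
    case False
    then show ?thesis using \<open>0 < p\<close> by (auto simp: coeff_path_poly)
  qed
  have "(\<Sum>j\<le>m. ?b j * coeff (path_poly a j) d) =
      (\<Sum>j\<le>m. (if j = d then ?b d else 0) - (if d = 0 \<and> j = p then (a p)\<^sup>2 else 0))"
    using split by (intro sum.cong) auto
  also have "\<dots> = (if d \<le> m then ?b d else 0) - (if d = 0 then (a p)\<^sup>2 else 0)"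
    using \<open>p \<le> m\<close> by (cases "d = 0") (simp_all add: sum_subtractf)
  finally have "coeff (char_poly (bordered_path_mat m a c)) d = coeff (pCons 0 (path_poly a m)) d -
      ((if d \<le> m then ?b d else 0) - (if d = 0 then (a p)\<^sup>2 else 0))"
    unfolding char_poly_bordered_path_mat by (simp add: coeff_sum)
  then show ?thesis using p by (auto simp: coeff_pCons coeff_path_poly Suc_diff_Suc split: nat.splits)
qed

subsection \<open>Nonnegative matrices of even size with a coefficient gap\<close>

lemma nonneg_matD:
  "A \<in> carrier_mat n n \<Longrightarrow> nonneg_mat A \<Longrightarrow> i < n \<Longrightarrow> j < n \<Longrightarrow> 0 \<le> A $$ (i, j)"
  by (auto simp: nonneg_mat_def)

lemma nonneg_mat_pow:
  assumes A: "A \<in> carrier_mat n n" "nonneg_mat A"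
  shows "nonneg_mat (A ^\<^sub>m s)"
proof (induction s)
  case (Suc s)
  then have "0 \<le> (A ^\<^sub>m s * A) $$ (i, j)" if "i < n" "j < n" for i j
    unfolding index_mult_mat_sum[OF pow_carrier_mat[OF A(1)] A(1) that] using that
    by (auto intro!: sum_nonneg mult_nonneg_nonneg nonneg_matD[OF A]
      nonneg_matD[OF pow_carrier_mat[OF A(1)]])
  then show ?case using A by (simp add: nonneg_mat_def)
qed (simp add: nonneg_mat_def)

lemma nonneg_mat_mult_pos:
  assumes "A \<in> carrier_mat n n" "B \<in> carrier_mat n n" "nonneg_mat A" "nonneg_mat B"
    and "i < n" "l < n" "j < n" "0 < A $$ (i, l)" "0 < B $$ (l, j)"
  shows "0 < (A * B) $$ (i, j)"
proof -
  have "0 < A $$ (i, l) * B $$ (l, j)" using assms by simp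
  also have "\<dots> \<le> (\<Sum>l<n. A $$ (i, l) * B $$ (l, j))"
    using assms by (intro member_le_sum) (auto intro!: mult_nonneg_nonneg nonneg_matD)
  finally show ?thesis unfolding index_mult_mat_sum[OF assms(1,2,5,7)] .
qed

lemma nonneg_mat_mult_eq_0:
  assumes "A \<in> carrier_mat n n" "B \<in> carrier_mat n n" "nonneg_mat A" "nonneg_mat B"
    and "i < n" "l < n" "j < n" "(A * B) $$ (i, j) = 0" "A $$ (i, l) \<noteq> 0"
  shows "B $$ (l, j) = 0"
  using nonneg_mat_mult_pos[OF assms(1-7)] nonneg_matD[OF assms(1,3,5,6)]
    nonneg_matD[OF assms(2,4,6,7)] assms(8,9)
  by (auto simp: order.order_iff_strict)

lemma irreducible_matD:
  assumes "A \<in> carrier_mat n n" "irreducible_mat A" "i \<in> S" "S \<subseteq> {..<n}"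
    and "\<And>i j. i \<in> S \<Longrightarrow> j < n \<Longrightarrow> A $$ (i, j) \<noteq> 0 \<Longrightarrow> j \<in> S"
  shows "S = {..<n}"
  using assms irreducible_mat_iff[OF assms(1)] by blast

text \<open>This is \<open>newton_trace\<close> at index n - l: the summand s = 0 contributes n
  times its coefficient, s = l carries the leading coefficient 1, and larger s point beyond the
  degree.\<close>

lemma trace_newton:
  fixes A :: "'a :: idom mat"
  assumes A: "A \<in> carrier_mat n n" and l: "0 < l" "l \<le> n"
  shows "trace_mat (A ^\<^sub>m l) = - of_nat l * coeff (char_poly A) (n - l) -
    (\<Sum>s = 1..<l. coeff (char_poly A) (n - l + s) * trace_mat (A ^\<^sub>m s))"
proof -
  let ?c = "coeff (char_poly A)" and ?t = "\<lambda>s. trace_mat (A ^\<^sub>m s)"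
  have "of_nat (n - l) * ?c (n - l) = (\<Sum>s\<le>n. ?c (n - l + s) * ?t s)"
    by (rule newton_trace[OF A])
  also have "\<dots> = (\<Sum>s\<in>insert 0 (insert l {1..<l}). ?c (n - l + s) * ?t s)"
    using l degree_monic_char_poly[OF A] by (intro sum.mono_neutral_right) (auto simp: coeff_eq_0)
  also have "\<dots> = ?c (n - l) * ?t 0 + (?t l + (\<Sum>s = 1..<l. ?c (n - l + s) * ?t s))"
    using l degree_monic_char_poly[OF A] by simp
  also have "?t 0 = of_nat n" using A by (simp add: trace_mat_def)
  finally show ?thesis using l by (simp add: of_nat_diff algebra_simps eq_neg_iff_add_eq_0)
qed

section \<open>Traces of powers when the coefficients strictly between p and 2 p vanish\<close>

context
  fixes A :: "'a :: idom mat" and p :: nat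
  assumes A: "A \<in> carrier_mat (2 * p) (2 * p)" and p: "0 < p"
    and gap: "\<And>d. p < d \<Longrightarrow> d < 2 * p \<Longrightarrow> coeff (char_poly A) d = 0"
begin

lemma trace_gap_less:
  assumes "0 < l" "l < p"
  shows "trace_mat (A ^\<^sub>m l) = 0"
proof -
  have "(\<Sum>s = 1..<l. coeff (char_poly A) (2 * p - l + s) * trace_mat (A ^\<^sub>m s)) = 0"
    using assms by (intro sum.neutral) (auto simp: gap)
  then show ?thesis using trace_newton[OF A, of l] assms by (simp add: gap)
qed

text \<open>In each product of the sum in \<open>trace_newton\<close>, either s < p and the trace
  vanishes, or the coefficient index lies in the gap.\<close>

lemma trace_gap:
  assumes "p \<le> l" "l < 2 * p"
  shows "trace_mat (A ^\<^sub>m l) = - of_nat l * coeff (char_poly A) (2 * p - l)"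
proof -
  have "(\<Sum>s = 1..<l. coeff (char_poly A) (2 * p - l + s) * trace_mat (A ^\<^sub>m s)) = 0"
  proof (intro sum.neutral ballI)
    fix s assume s: "s \<in> {1..<l}"
    show "coeff (char_poly A) (2 * p - l + s) * trace_mat (A ^\<^sub>m s) = 0"
      using s assms by (cases "s < p") (auto simp: gap trace_gap_less)
  qed
  then show ?thesis using trace_newton[OF A, of l] assms p by simp
qed

text \<open>Here s = p alone escapes both reasons for vanishing and contributes the quadratic
  term.\<close>

lemma trace_gap_last:
  "trace_mat (A ^\<^sub>m (2 * p)) =
    of_nat p * (coeff (char_poly A) p)\<^sup>2 - of_nat (2 * p) * coeff (char_poly A) 0"
proof -
  have "(\<Sum>s = 1..<2 * p. coeff (char_poly A) s * trace_mat (A ^\<^sub>m s)) =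
      (\<Sum>s\<in>{p}. coeff (char_poly A) s * trace_mat (A ^\<^sub>m s))"
  proof (intro sum.mono_neutral_right ballI)
    fix s assume s: "s \<in> {1..<2 * p} - {p}"
    then consider "0 < s" "s < p" | "p < s" "s < 2 * p" by fastforce
    then show "coeff (char_poly A) s * trace_mat (A ^\<^sub>m s) = 0"
      by cases (auto simp: gap trace_gap_less)
  qed (use p in auto)
  then show ?thesis
    using trace_newton[OF A, of "2 * p"] p trace_gap[of p]
    by (simp add: power2_eq_square algebra_simps)
qed

end

section \<open>Cauchy--Schwarz and the coefficient inequalities\<close>

context
  fixes A :: "real mat" and p :: nat and w :: real
  assumes A: "A \<in> carrier_mat (2 * p) (2 * p)" "nonneg_mat A" and p: "0 < p"
    and gap: "\<And>d. p < d \<Longrightarrow> d < 2 * p \<Longrightarrow> coeff (char_poly A) d = 0"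
    and w: "coeff (char_poly A) p = - 2 * w"
begin

text \<open>As tr(A^p) = 2 p w, \<open>w\<close> is the mean of the diagonal of A^p. By
  nonnegativity, dropping the off-diagonal products bounds the sum of squares by tr(A^(2p)). The
  defect stays explicit so that the equality case can be read off.\<close>

lemma sum_diag_deviation_le:
  "(\<Sum>i<2 * p. ((A ^\<^sub>m p) $$ (i, i) - w)\<^sup>2) \<le> 2 * real p * (w\<^sup>2 - coeff (char_poly A) 0)"
proof -
  let ?B = "A ^\<^sub>m p"
  have B: "?B \<in> carrier_mat (2 * p) (2 * p)" "nonneg_mat ?B"
    using A nonneg_mat_pow[OF A] by auto
  have t1: "(\<Sum>i<2 * p. ?B $$ (i, i)) = 2 * real p * w"
    using trace_gap[OF A(1) p gap, of p] A p w by (simp add: trace_mat_def)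
  have "(\<Sum>i<2 * p. (?B $$ (i, i))\<^sup>2) \<le> (\<Sum>i<2 * p. \<Sum>l<2 * p. ?B $$ (i, l) * ?B $$ (l, i))"
    unfolding power2_eq_square
    by (intro sum_mono member_le_sum[of _ _ "\<lambda>l. ?B $$ (_, l) * ?B $$ (l, _)"])
      (auto intro!: mult_nonneg_nonneg nonneg_matD[OF B])
  also have "\<dots> = (\<Sum>i<2 * p. (?B * ?B) $$ (i, i))"
    by (intro sum.cong refl index_mult_mat_sum[symmetric] B) auto
  also have "\<dots> = trace_mat (A ^\<^sub>m (2 * p))"
    using pow_mat_add[OF A(1), of p p] A(1) by (simp add: trace_mat_def mult_2)
  also have "\<dots> = 4 * real p * w\<^sup>2 - 2 * real p * coeff (char_poly A) 0"
    using trace_gap_last[OF A(1) p gap] w by (simp add: power_mult_distrib)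
  finally have t2: "(\<Sum>i<2 * p. (?B $$ (i, i))\<^sup>2) \<le> \<dots>" .
  have "(\<Sum>i<2 * p. (?B $$ (i, i) - w)\<^sup>2) =
      (\<Sum>i<2 * p. (?B $$ (i, i))\<^sup>2) - 2 * w * (\<Sum>i<2 * p. ?B $$ (i, i)) + 2 * real p * w\<^sup>2"
    by (simp add: power2_diff sum.distrib sum_subtractf sum_distrib_left mult_ac)
  also have "\<dots> \<le> 2 * real p * (w\<^sup>2 - coeff (char_poly A) 0)"
    using t2 unfolding t1 by (simp add: algebra_simps power2_eq_square)
  finally show ?thesis .
qed

lemma coeff_char_poly_nonpos:
  assumes "0 < d" "d \<le> p"
  shows "coeff (char_poly A) d \<le> 0"
proof -
  have "0 \<le> trace_mat (A ^\<^sub>m (2 * p - d))"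
    using A nonneg_mat_pow[OF A, of "2 * p - d"]
    by (auto simp: trace_mat_def intro!: sum_nonneg nonneg_matD[of _ "2 * p"])
  also have "\<dots> = - real (2 * p - d) * coeff (char_poly A) d"
    using trace_gap[OF A(1) p gap, of "2 * p - d"] assms by simp
  finally show ?thesis using assms by (simp add: mult_le_0_iff zero_le_mult_iff)
qed

lemma coeff_0_char_poly_le: "coeff (char_poly A) 0 \<le> w\<^sup>2"
proof -
  have "0 \<le> 2 * real p * (w\<^sup>2 - coeff (char_poly A) 0)"
    using sum_diag_deviation_le by (rule order_trans[rotated]) (simp add: sum_nonneg)
  then show ?thesis using p by (simp add: zero_le_mult_iff)
qed

end

section \<open>The exceptional case (x^p - w)^2\<close>

text \<open>The indices of the zero rows of \<open>C\<close> are closed under the arcs of \<open>A\<close>.\<close>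
lemma irreducible_mat_commuting_square_zero:
  assumes A: "A \<in> carrier_mat n n" "nonneg_mat A" "irreducible_mat A"
    and C: "C \<in> carrier_mat n n" "nonneg_mat C"
    and comm: "A * C = C * A" and square: "C * C = 0\<^sub>m n n"
  shows "C = 0\<^sub>m n n"
proof (rule ccontr)
  assume "C \<noteq> 0\<^sub>m n n"
  then obtain i j where ij: "i < n" "j < n" "C $$ (i, j) \<noteq> 0"
    using C(1) by (metis carrier_matD eq_matI index_zero_mat)
  define S where "S = {i. i < n \<and> (\<forall>j<n. C $$ (i, j) = 0)}"
  \<comment> \<open>Nonnegative terms cannot cancel: \<open>C $$ (i, j)\<close> is nonzero and
    \<open>C * C\<close> is zero, so row j of \<open>C\<close> vanishes.\<close>
  have "j \<in> S"
    using nonneg_mat_mult_eq_0[OF C(1) C(1) C(2) C(2) ij(1,2) _ _ ij(3)] ij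
    by (auto simp: S_def square)
  then have "S = {..<n}"
  proof (rule irreducible_matD[OF A(1,3)])
    fix i l assume i: "i \<in> S" and l: "l < n" "A $$ (i, l) \<noteq> 0"
    have "C $$ (l, j) = 0" if "j < n" for j
    proof (rule nonneg_mat_mult_eq_0[OF A(1) C(1) A(2) C(2) _ l(1) that _ l(2)])
      show "(A * C) $$ (i, j) = 0"
        unfolding comm index_mult_mat_sum[OF C(1) A(1) _ that] using i that
        by (subst index_mult_mat_sum[OF C(1) A(1)]) (auto simp: S_def)
    qed (use i in \<open>auto simp: S_def\<close>)
    then show "l \<in> S" using l by (simp add: S_def)
  qed (auto simp: S_def)
  then show False using ij by (auto simp: S_def)
qed

text \<open>For each \<open>t\<close> at most one index can be reached from \<open>0\<close> by a walk of length \<open>t\<close>,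
  and walks of length \<open>p\<close> lead back to \<open>0\<close>.\<close>
lemma irreducible_mat_pow_scalar:
  assumes A: "A \<in> carrier_mat n n" "nonneg_mat A" "irreducible_mat A"
    and p: "0 < p" and w: "0 < w" and Ap: "A ^\<^sub>m p = w \<cdot>\<^sub>m 1\<^sub>m n"
  shows "n \<le> p"
proof (cases "n = 0")
  case False
  note car = pow_carrier_mat[OF A(1)] and nn = nonneg_mat_pow[OF A(1,2)]
  have prod: "A ^\<^sub>m a * A ^\<^sub>m b = w \<cdot>\<^sub>m 1\<^sub>m n" if "a + b = p" for a b
    using pow_mat_add[OF A(1), of a b] Ap that by simp
  \<comment> \<open>A walk of length t followed by one of length p - t gives a positive entry of the
    scalar matrix A^p, hence is closed.\<close>
  have home: "l = i" if "t \<le> p" "i < n" "j < n" "l < n"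
    "0 < (A ^\<^sub>m t) $$ (i, j)" "0 < (A ^\<^sub>m (p - t)) $$ (j, l)" for t i j l
    using nonneg_mat_mult_pos[OF car car nn nn that(2,3,4,5,6)] prod[of t "p - t"] that
    by (auto split: if_splits)
  define R where "R t = {j. j < n \<and> 0 < (A ^\<^sub>m t) $$ (0, j)}" for t
  have unique: "j = j'" if t: "t \<le> p" and j: "j \<in> R t" "j' \<in> R t" for t j j'
  proof -
    \<comment> \<open>A zero row j of A^(p - t) would make the diagonal entry w of A^p
      vanish.\<close>
    have "\<exists>l<n. (A ^\<^sub>m (p - t)) $$ (j, l) \<noteq> 0"
    proof (rule ccontr)
      assume "\<not> (\<exists>l<n. (A ^\<^sub>m (p - t)) $$ (j, l) \<noteq> 0)"
      then have "(A ^\<^sub>m (p - t) * A ^\<^sub>m t) $$ (j, j) = 0"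
        using j by (subst index_mult_mat_sum[OF car car]) (auto simp: R_def)
      then show False using prod[of "p - t" t] t j w by (simp add: R_def)
    qed
    then obtain l where l: "l < n" "(A ^\<^sub>m (p - t)) $$ (j, l) \<noteq> 0" by blast
    then have pos: "0 < (A ^\<^sub>m (p - t)) $$ (j, l)"
      using nonneg_matD[OF car nn, of j l "p - t"] j by (auto simp: R_def)
    then have "l = 0" using home[of t 0 j l] t j l False by (simp add: R_def)
    \<comment> \<open>The same halves in the other order: from j to 0 and then from 0 to j' is again
      a walk of length p, hence closed.\<close>
    then show ?thesis using home[of "p - t" j 0 j'] pos t j False by (simp add: R_def)
  qed
  have card: "card (R t) \<le> 1" if "t < p" for t
    using unique[of t] that by (auto simp: card_le_Suc0_iff_eq R_def)
  have "0 \<in> R 0" using A False by (simp add: R_def)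
  then have "0 \<in> (\<Union>t<p. R t)" using p by blast
  then have "(\<Union>t<p. R t) = {..<n}"
  proof (rule irreducible_matD[OF A(1,3)])
    fix i j assume i: "i \<in> (\<Union>t<p. R t)" and j: "j < n" "A $$ (i, j) \<noteq> 0"
    obtain t where t: "t < p" "i \<in> R t" using i by blast
    have "0 < A $$ (i, j)" using nonneg_matD[OF A(1,2), of i j] t j by (auto simp: R_def)
    then have "0 < (A ^\<^sub>m t * A) $$ (0, j)"
      using t j False by (intro nonneg_mat_mult_pos[OF car A(1) nn A(2)]) (auto simp: R_def)
    then have *: "j \<in> R (Suc t)" using j by (simp add: R_def)
    show "j \<in> (\<Union>t<p. R t)"
    \<comment> \<open>After p steps every walk is back at 0, which already lies in
      \<open>R 0\<close>; so the sets with t < p suffice.\<close>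
    proof (cases "Suc t = p")
      case True
      then have "j = 0" using * False by (auto simp: R_def Ap simp del: pow_mat.simps split: if_splits)
      then show ?thesis using \<open>0 \<in> (\<Union>t<p. R t)\<close> by simp
    qed (use * t in auto)
  qed (auto simp: R_def)
  then have "n = card (\<Union>t<p. R t)" by simp
  also have "\<dots> \<le> (\<Sum>t<p. card (R t))" by (rule card_UN_le) simp
  also have "\<dots> \<le> p" using sum_mono[of "{..<p}" "\<lambda>t. card (R t)" "\<lambda>_. 1"] card by simp
  finally show ?thesis .
qed simp

lemma not_irreducible_mat_square:
  assumes A: "A \<in> carrier_mat (2 * p) (2 * p)" "nonneg_mat A" and p: "0 < p" and w: "0 < w"
    and \<chi>: "char_poly A = monom 1 (2 * p) - monom (2 * w) p + [:w\<^sup>2:]"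
  shows "\<not> irreducible_mat A"
proof
  assume irr: "irreducible_mat A"
  let ?n = "2 * p"
  define B where "B = A ^\<^sub>m p"
  define C where "C = B - w \<cdot>\<^sub>m 1\<^sub>m ?n"
  have c: "coeff (char_poly A) d =
      (if d = ?n then 1 else if d = p then - 2 * w else if d = 0 then w\<^sup>2 else 0)" for d
    using p unfolding \<chi> by (auto simp: coeff_pCons split: nat.split)
  have B: "B \<in> carrier_mat ?n ?n" "nonneg_mat B"
    using A nonneg_mat_pow[OF A] by (auto simp: B_def)
  have C: "C \<in> carrier_mat ?n ?n" by (intro carrier_matI) (simp_all add: C_def)
  \<comment> \<open>The constant coefficient is w^2, so the bound on the deviation is 0.\<close>
  have "(\<Sum>i<?n. (B $$ (i, i) - w)\<^sup>2) \<le> 0"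
    using sum_diag_deviation_le[OF A p, of w] p by (simp add: c B_def)
  then have "(\<Sum>i<?n. (B $$ (i, i) - w)\<^sup>2) = 0" by (intro antisym sum_nonneg) auto
  then have diag: "B $$ (i, i) = w" if "i < ?n" for i
    using that by (simp add: sum_nonneg_eq_0_iff)
  have C_nonneg: "nonneg_mat C"
    using B C diag unfolding nonneg_mat_def by (auto simp: C_def)
  have comm: "A * C = C * A"
  proof -
    have "A * B = B * A"
      using pow_mat_add[OF A(1), of 1 p] A unfolding B_def by simp
    then show ?thesis using A(1) B(1) unfolding C_def
      by (simp add: mult_minus_distrib_mat[of _ ?n ?n] minus_mult_distrib_mat[of _ ?n ?n]
        mult_smult_distrib[of _ ?n ?n _ ?n] mult_smult_assoc_mat[of _ ?n ?n _ ?n])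
  qed
  \<comment> \<open>Expanding (B - w I)^2 entrywise gives the characteristic polynomial evaluated at
    \<open>A\<close>.\<close>
  have "(C * C) $$ (i, j) = 0" if ij: "i < ?n" "j < ?n" for i j
  proof -
    have "(\<Sum>s\<le>?n. coeff (char_poly A) s * (A ^\<^sub>m s) $$ (i, j)) =
        (\<Sum>s\<in>{?n, p, 0}. coeff (char_poly A) s * (A ^\<^sub>m s) $$ (i, j))"
      by (intro sum.mono_neutral_right) (auto simp: c)
    then have "(A ^\<^sub>m ?n) $$ (i, j) - 2 * w * B $$ (i, j) + w\<^sup>2 * (1\<^sub>m ?n) $$ (i, j) = 0"
      using cayley_hamilton_index[OF A(1) ij] p A(1) by (simp add: c B_def)
    moreover have "A ^\<^sub>m ?n = B * B"
      using pow_mat_add[OF A(1), of p p] by (simp add: B_def mult_2)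
    moreover have "(C * C) $$ (i, j) =
        (\<Sum>l<?n. B $$ (i, l) * B $$ (l, j) - (if l = j then w * B $$ (i, j) else 0) -
          (if l = i then w * B $$ (i, j) else 0) + (if l = i then w\<^sup>2 * (1\<^sub>m ?n) $$ (i, j) else 0))"
      unfolding index_mult_mat_sum[OF C C ij] using ij B(1)
      by (intro sum.cong) (auto simp: C_def algebra_simps power2_eq_square)
    then have "(C * C) $$ (i, j) = (B * B) $$ (i, j) - 2 * w * B $$ (i, j) + w\<^sup>2 * (1\<^sub>m ?n) $$ (i, j)"
      using ij by (simp add: sum.distrib sum_subtractf index_mult_mat_sum[OF B(1) B(1) ij])
    ultimately show ?thesis by simp
  qed
  then have "C * C = 0\<^sub>m ?n ?n" using C by (intro eq_matI) auto
  then have "C = 0\<^sub>m ?n ?n"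
    using irreducible_mat_commuting_square_zero[OF A irr C C_nonneg comm] by blast
  have "B = w \<cdot>\<^sub>m 1\<^sub>m ?n"
  proof (rule eq_matI)
    fix i j assume ij: "i < dim_row (w \<cdot>\<^sub>m 1\<^sub>m ?n)" "j < dim_col (w \<cdot>\<^sub>m 1\<^sub>m ?n)"
    then have "C $$ (i, j) = 0" using \<open>C = 0\<^sub>m ?n ?n\<close> by simp
    then show "B $$ (i, j) = (w \<cdot>\<^sub>m 1\<^sub>m ?n) $$ (i, j)" using ij by (simp add: C_def)
  qed (use B in auto)
  then show False using irreducible_mat_pow_scalar[OF A irr p w] p by (simp add: B_def)
qed

section \<open>The two claims about P\<close>

theorem theorem27:
  fixes p :: nat and k :: "nat \<Rightarrow> real" and P :: "real poly"
  assumes "p \<ge> 3"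
    and "P = monom 1 (2 * p) + (\<Sum>i = p..2 * p. monom (k i) (2 * p - i))"
    and "P \<noteq> monom 1 (2 * p)"
  defines "star \<equiv> k p < 0 \<and> (\<forall>i \<in> {p + 1..2 * p - 1}. k i = 0) \<and> k (2 * p) = (k p)\<^sup>2 / 4"
  shows "(\<not> star \<longrightarrow> (realizable P \<longleftrightarrow> irreducibly_realizable P)) \<and>
         (star \<longrightarrow> \<not> irreducibly_realizable P)"
proof -
  have p: "0 < p" using assms(1) by simp
  have coeff_P: "coeff P d = (if d = 2 * p then 1 else if d \<le> p then k (2 * p - d) else 0)" for d
  proof -
    have "coeff P d = (if d = 2 * p then 1 else 0) +
        (\<Sum>i = p..2 * p. if 2 * p - i = d then k i else 0)"
      by (simp add: assms(2) coeff_sum)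
    also have "(\<Sum>i = p..2 * p. if 2 * p - i = d then k i else 0) =
        (\<Sum>i = p..2 * p. if i = 2 * p - d then (if d \<le> p then k (2 * p - d) else 0) else 0)"
      by (intro sum.cong) auto
    also have "\<dots> = (if d \<le> p then k (2 * p - d) else 0)" by auto
    finally show ?thesis using p by simp
  qed
  have deg: "degree P = 2 * p"
  proof (rule antisym)
    show "degree P \<le> 2 * p" by (rule degree_le) (simp add: coeff_P)
    show "2 * p \<le> degree P" by (rule le_degree) (simp add: coeff_P)
  qed
  have irr: "irreducibly_realizable P" if P_real: "realizable P" and not_star: "\<not> star"
  proof -
    obtain A where A: "A \<in> carrier_mat (2 * p) (2 * p)" "nonneg_mat A" and \<chi>: "char_poly A = P"
      using P_real unfolding realizable_def deg by blast
    have gap: "coeff (char_poly A) d = 0" if "p < d" "d < 2 * p" for d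
      using that by (simp add: \<chi> coeff_P)
    have mid: "coeff (char_poly A) p = - 2 * (- k p / 2)"
      using p by (simp add: \<chi> coeff_P)
    have k_le: "k l \<le> 0" if "p \<le> l" "l < 2 * p" for l
      using coeff_char_poly_nonpos[OF A p gap mid, of "2 * p - l"] that by (simp add: \<chi> coeff_P)
    have k_last: "k (2 * p) \<le> (k p)\<^sup>2 / 4"
      using coeff_0_char_poly_le[OF A p gap mid] p by (simp add: \<chi> coeff_P power_divide)
    define m where "m = 2 * p - 1"
    have m: "2 * p = Suc m" using p by (simp add: m_def)
    \<comment> \<open>Two cycles of length l share the weight - k l. The cut beyond \<open>m\<close>
      keeps \<open>a\<close> nonnegative, since \<open>k (2 * p)\<close> may be positive; length 2 p
      is handled by \<open>c\<close>.\<close>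
    define a where "a l = (if p \<le> l \<and> l \<le> m then - k l / 2 else 0)" for l
    \<comment> \<open>The two disjoint p-cycles contribute (k p)^2 / 4 to the constant coefficient;
      \<open>c\<close> corrects the difference.\<close>
    define c where "c = (k p)\<^sup>2 / 4 - k (2 * p)"
    let ?H = "bordered_path_mat m a c"
    have H: "?H \<in> carrier_mat (2 * p) (2 * p)" by (simp add: m)
    have a: "0 \<le> a l" for l using k_le[of l] m by (simp add: a_def)
    have c: "0 \<le> c" using k_last by (simp add: c_def)
    have "char_poly ?H = P"
    proof (rule poly_eqI)
      fix d
      have "p \<le> m" using m p by simp
      then show "coeff (char_poly ?H) d = coeff P d"
        using coeff_char_poly_bordered_path_mat[OF _ m, of a c d] m
        by (auto simp: coeff_P a_def c_def power_divide)
    qed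
    moreover have "nonneg_mat ?H"
      using a c unfolding nonneg_mat_def bordered_path_mat_def by (auto simp: add_nonneg_nonneg)
    moreover have "irreducible_mat ?H"
    proof (rule irreducible_bordered_path_mat[OF a c], rule ccontr)
      \<comment> \<open>Without a way back from the last vertex only \<open>k p\<close> and the
        matching constant coefficient can survive; as \<open>star\<close> fails, these vanish too
        and P is the excluded monomial.\<close>
      assume not: "\<not> (0 < c \<or> (\<exists>l\<le>m. Suc m < 2 * l \<and> 0 < a l))"
      then have last: "k (2 * p) = (k p)\<^sup>2 / 4" using c by (simp add: c_def)
      have zero: "k l = 0" if "p < l" "l < 2 * p" for l
      proof -
        have "\<not> 0 < a l" using not that m by auto
        then show ?thesis using a[of l] that m by (simp add: a_def)
      qed
      then have "\<not> k p < 0" using not_star last unfolding star_def by auto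
      then have "k p = 0" using k_le[of p] p by simp
      then have "P = monom 1 (2 * p)"
      proof (intro poly_eqI)
        fix d
        consider "d = 0" | "0 < d" "d < p" | "d = p" | "p < d" by linarith
        then show "coeff P d = coeff (monom 1 (2 * p)) d"
          using \<open>k p = 0\<close> zero[of "2 * p - d"] last p by cases (auto simp: coeff_P)
      qed
      then show False using assms(3) by simp
    qed
    ultimately show ?thesis unfolding irreducibly_realizable_def deg using H by blast
  qed
  have "\<not> irreducibly_realizable P" if star
  proof
    assume "irreducibly_realizable P"
    then obtain A where A: "A \<in> carrier_mat (2 * p) (2 * p)" "nonneg_mat A"
      and A_irr: "irreducible_mat A" and \<chi>: "char_poly A = P"
      unfolding irreducibly_realizable_def deg by blast
    from \<open>star\<close> have s: "k p < 0" "\<And>i. p < i \<Longrightarrow> i < 2 * p \<Longrightarrow> k i = 0"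
      "k (2 * p) = (k p)\<^sup>2 / 4"
      unfolding star_def by auto
    \<comment> \<open>Under \<open>star\<close>, P is (x^p - w)^2 with w = - k p / 2 > 0.\<close>
    have "P = monom 1 (2 * p) - monom (2 * (- k p / 2)) p + [:(- k p / 2)\<^sup>2:]"
    proof (rule poly_eqI)
      fix d
      consider "d = 0" | "0 < d" "d < p" | "d = p" | "p < d" by linarith
      then show "coeff P d = coeff (monom 1 (2 * p) - monom (2 * (- k p / 2)) p + [:(- k p / 2)\<^sup>2:]) d"
        using s p by cases (auto simp: coeff_P coeff_pCons power_divide split: nat.split)
    qed
    then show False
      using not_irreducible_mat_square[OF A p, of "- k p / 2"] A_irr s(1) \<chi> by simp
  qed
  moreover have "realizable P" if "irreducibly_realizable P"
    using that unfolding realizable_def irreducibly_realizable_def by blast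
  ultimately show ?thesis using irr by blast
qed

end
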